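(* Let $\mathcal{R}$ be an associative ring with unit $1\neq 0$ and with an involution $\ast$, and let $a,x\in\mathcal{R}$. Then the following assertions are equivalent: (1) $x\in a\{1,3\}$ in the sense that $axa=a$ and $(ax)^{\ast}=ax$. (2) $\varphi_{ax}=\rho_{a\mathcal{R},\,{\rm rann}(a^{\ast})}$. (3) ${}_{ax}\varphi=\rho_{\mathcal{R}a^{\ast},\,{\rm lann}(a)}$.
   Context: An involution of $\mathcal{R}$ is a map $a\mapsto a^{\ast}$ with $(a^{\ast})^{\ast}=a$, $(a+b)^{\ast}=a^{\ast}+b^{\ast}$, $(ab)^{\ast}=b^{\ast}a^{\ast}$. Notation: $a\mathcal{R}=\{ar:r\in\mathcal{R}\}$, $\mathcal{R}a=\{ra:r\in\mathcal{R}\}$, ${\rm rann}(a)=\{r\in\mathcal{R}:ar=0\}$, ${\rm lann}(a)=\{r\in\mathcal{R}:ra=0\}$. The additive group endomorphisms $\varphi_a,{}_a\varphi:\mathcal{R}\to\mathcal{R}$ are $\varphi_a(r)=ar$ and ${}_a\varphi(r)=ra$. For additive subgroups $\mathcal{S},\mathcal{T}$ of $\mathcal{R}$, $\mathcal{R}=\mathcal{S}\oplus\mathcal{T}$ means $\mathcal{R}=\mathcal{S}+\mathcal{T}$ and $\mathcal{S}\cap\mathcal{T}=\{0\}$; in that case $\rho_{\mathcal{S},\mathcal{T}}:\mathcal{R}\to\mathcal{R}$ is the group endomorphism $\rho_{\mathcal{S},\mathcal{T}}(s+t)=s$ for $s\in\mathcal{S}$, $t\in\mathcal{T}$. Convention: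 whenever $\rho_{\mathcal{S},\mathcal{T}}$ is written, it is implicitly asserted that $\mathcal{R}=\mathcal{S}\oplus\mathcal{T}$. *)

theory Defs
  imports Complex_Main "HOL-Library.Set_Algebras"
begin

text \<open>The ring is a type of class \<^class>\<open>ring_1\<close> (associative, unital, \<open>0 \<noteq> 1\<close>); commutativity
  is not assumed.\<close>

definition involution :: "('a::ring_1 \<Rightarrow> 'a) \<Rightarrow> bool" where
  "involution star \<longleftrightarrow>
     (\<forall>a. star (star a) = a) \<and>
     (\<forall>a b. star (a + b) = star a + star b) \<and>
     (\<forall>a b. star (a * b) = star b * star a)"

definition right_ideal_of :: "'a::ring_1 \<Rightarrow> 'a set" where
  "right_ideal_of a = {a * r |r. True}"

definition left_ideal_of :: "'a::ring_1 \<Rightarrow> 'a set" where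
  "left_ideal_of a = {r * a |r. True}"

definition rann :: "'a::ring_1 \<Rightarrow> 'a set" where
  "rann a = {r. a * r = 0}"

definition lann :: "'a::ring_1 \<Rightarrow> 'a set" where
  "lann a = {r. r * a = 0}"

definition left_mult :: "'a::ring_1 \<Rightarrow> 'a \<Rightarrow> 'a" where
  "left_mult a = (\<lambda>r. a * r)"

definition right_mult :: "'a::ring_1 \<Rightarrow> 'a \<Rightarrow> 'a" where
  "right_mult a = (\<lambda>r. r * a)"

definition additive_subgroup :: "'a::ring_1 set \<Rightarrow> bool" where
  "additive_subgroup S \<longleftrightarrow> 0 \<in> S \<and> (\<forall>x\<in>S. \<forall>y\<in>S. x + y \<in> S) \<and> (\<forall>x\<in>S. - x \<in> S)"

text \<open>Internal direct decomposition of the whole ring; meant for additive subgroups, and \<open>S + T\<close> is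
  the elementwise sum of sets from \<^theory>\<open>HOL-Library.Set_Algebras\<close>.\<close>

definition direct_sum_decomp :: "'a::ring_1 set \<Rightarrow> 'a set \<Rightarrow> bool" where
  "direct_sum_decomp S T \<longleftrightarrow> S + T = UNIV \<and> S \<inter> T = {0}"

text \<open>The projection onto \<open>S\<close> along \<open>T\<close>. It has the intended meaning only if
  \<^const>\<open>direct_sum_decomp\<close> holds for \<open>S\<close> and \<open>T\<close>.\<close>

definition proj_along :: "'a::ring_1 set \<Rightarrow> 'a set \<Rightarrow> 'a \<Rightarrow> 'a" where
  "proj_along S T r = (THE s. s \<in> S \<and> (\<exists>t\<in>T. r = s + t))"

text \<open>The equation \<open>f = \<rho>\<^bsub>S,T\<^esub>\<close>, which by convention also asserts that the ring is the direct sum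
  of \<open>S\<close> and \<open>T\<close>.\<close>

definition is_proj_along :: "('a::ring_1 \<Rightarrow> 'a) \<Rightarrow> 'a set \<Rightarrow> 'a set \<Rightarrow> bool" where
  "is_proj_along f S T \<longleftrightarrow> direct_sum_decomp S T \<and> f = proj_along S T"

definition inverses_13 :: "('a::ring_1 \<Rightarrow> 'a) \<Rightarrow> 'a \<Rightarrow> 'a set" where
  "inverses_13 star a = {x. a * x * a = a \<and> star (a * x) = a * x}"

lemma additive_subgroup_ideals:
  "additive_subgroup (right_ideal_of a)" "additive_subgroup (left_ideal_of a)"
  "additive_subgroup (rann a)" "additive_subgroup (lann a)"
proof -
  show "additive_subgroup (right_ideal_of a)"
    unfolding additive_subgroup_def right_ideal_of_def
    by (auto, metis mult_zero_right, metis distrib_left, metis mult_minus_right)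
  show "additive_subgroup (left_ideal_of a)"
    unfolding additive_subgroup_def left_ideal_of_def
    by (auto, metis mult_zero_left, metis distrib_right, metis mult_minus_left)
  show "additive_subgroup (rann a)" "additive_subgroup (lann a)"
    unfolding additive_subgroup_def rann_def lann_def by (auto simp: algebra_simps)
qed

lemma proj_along_add:
  assumes S: "additive_subgroup S" and T: "additive_subgroup T"
    and dec: "direct_sum_decomp S T" and s: "s \<in> S" and t: "t \<in> T"
  shows "proj_along S T (s + t) = s"
  unfolding proj_along_def
proof (rule the_equality)
  show "s \<in> S \<and> (\<exists>t'\<in>T. s + t = s + t')" using s t by blast
next
  fix s' assume "s' \<in> S \<and> (\<exists>t'\<in>T. s + t = s' + t')"
  then obtain t' where s': "s' \<in> S" and t': "t' \<in> T" and eq: "s + t = s' + t'" by blast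
  have "s' + - s \<in> S" using S s s' unfolding additive_subgroup_def by blast
  moreover have "t + - t' \<in> T" using T t t' unfolding additive_subgroup_def by blast
  moreover have "s' + - s = t + - t'" using eq by (simp add: algebra_simps)
  ultimately have "s' + - s \<in> S \<inter> T" by (metis IntI)
  then have "s' + - s = 0" using dec unfolding direct_sum_decomp_def by blast
  then show "s' = s" by simp
qed

end

theory Submission
  imports Defs
begin

text \<open>All three assertions amount to the single equation \<open>a\<^sup>* a x = a\<^sup>*\<close>. That it characterizes the
  \<open>{1,3}\<close>-inverses is the normal-equation criterion (\<open>inverses_13_iff_normal_equation\<close>). For the
  projections, the criterion \<open>is_proj_along_iff\<close> replaces the decomposition of the ring by
  conditions on the map alone: multiplication by \<open>p = a x\<close> must take its values in the first
  summand, fix that summand, kill the second one, and leave a remainder in the second one.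
  Taking the remainder of \<open>1\<close> for left multiplication, or the image of \<open>a\<^sup>*\<close> for right
  multiplication, yields the normal equation. Conversely, the normal equation gives \<open>p a = a\<close> and
  \<open>p = p\<^sup>* = x\<^sup>* a\<^sup>*\<close>; hence \<open>p\<close> lies both in the right ideal of \<open>a\<close> and in the left ideal of
  \<open>a\<^sup>*\<close>, and all the conditions on the two maps are read off.\<close>

text \<open>The conditions on the right produce the decomposition themselves: \<open>r = f r + (r - f r)\<close>, and an
  element of the intersection is both fixed and killed by \<open>f\<close>.\<close>

lemma is_proj_along_iff:
  assumes S: "additive_subgroup S" and T: "additive_subgroup T"
  shows "is_proj_along f S T \<longleftrightarrow>
    (\<forall>r. f r \<in> S \<and> r - f r \<in> T) \<and> (\<forall>s\<in>S. f s = s) \<and> (\<forall>t\<in>T. f t = 0)"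
    (is "_ \<longleftrightarrow> ?conds")
proof
  assume proj: "is_proj_along f S T"
  then have dec: "direct_sum_decomp S T"
    by (simp add: is_proj_along_def)
  have f_eq: "f (s + t) = s" if "s \<in> S" "t \<in> T" for s t
    using proj proj_along_add[OF S T dec that] by (simp add: is_proj_along_def)
  have "f r \<in> S \<and> r - f r \<in> T" for r
  proof -
    have "r \<in> S + T"
      using dec by (simp add: direct_sum_decomp_def)
    then obtain s t where "r = s + t" "s \<in> S" "t \<in> T"
      by (rule set_plus_elim)
    then show ?thesis
      by (simp add: f_eq)
  qed
  moreover have "f s = s" if "s \<in> S" for s
    using f_eq[OF that, of 0] T by (simp add: additive_subgroup_def)
  moreover have "f t = 0" if "t \<in> T" for t
    using f_eq[of 0, OF _ that] S by (simp add: additive_subgroup_def)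
  ultimately show ?conds
    by blast
next
  assume conds: ?conds
  have "r \<in> S + T" for r
    using set_plus_intro[of "f r" S "r - f r" T] conds by simp
  moreover have "S \<inter> T = {0}"
  proof
    show "S \<inter> T \<subseteq> {0}"
      using conds by fastforce
    show "{0} \<subseteq> S \<inter> T"
      using S T by (simp add: additive_subgroup_def)
  qed
  ultimately have dec: "direct_sum_decomp S T"
    by (auto simp: direct_sum_decomp_def)
  have "f r = proj_along S T r" for r
    using proj_along_add[OF S T dec, of "f r" "r - f r"] conds by simp
  with dec show "is_proj_along f S T"
    by (auto simp: is_proj_along_def)
qed

text \<open>Multiplying the normal equation by \<open>x\<^sup>*\<close> from the left gives \<open>(a x)\<^sup>* = (a x)\<^sup>* (a x)\<close>, whose
  right-hand side is symmetric. So \<open>a x\<close> is symmetric, and \<open>a x a = a\<close> is then the adjoint of the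
  normal equation. In the other direction one takes the adjoint of \<open>a = (a x) a\<close>.\<close>

lemma inverses_13_iff_normal_equation:
  assumes "involution star"
  shows "x \<in> inverses_13 star a \<longleftrightarrow> star a * a * x = star a"
proof -
  have star_star: "star (star b) = b" and star_mult: "star (b * c) = star c * star b" for b c
    using assms by (auto simp: involution_def)
  show ?thesis
  proof
    assume "x \<in> inverses_13 star a"
    then have "a * x * a = a" and sym: "star (a * x) = a * x"
      by (auto simp: inverses_13_def)
    then have "star a = star (a * x * a)"
      by simp
    also have "\<dots> = star a * star (a * x)"
      by (rule star_mult)
    also have "\<dots> = star a * a * x"
      by (simp add: sym mult.assoc)
    finally show "star a * a * x = star a" ..
  next
    assume normal: "star a * a * x = star a"
    have gram: "star (a * x) = star (a * x) * (a * x)"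
      using arg_cong[OF normal, of "\<lambda>y. star x * y"] by (simp add: star_mult mult.assoc)
    have "star (star (a * x)) = star (star (a * x) * (a * x))"
      using gram by (rule arg_cong)
    also have "\<dots> = star (a * x) * (a * x)"
      by (simp only: star_mult[of "star (a * x)"] star_star)
    finally have sym: "star (a * x) = a * x"
      using gram by (simp add: star_star)
    have "a = star (star a * (a * x))"
      using normal by (simp add: star_star mult.assoc)
    also have "\<dots> = star (a * x) * a"
      by (simp only: star_mult[of "star a"] star_star)
    finally show "x \<in> inverses_13 star a"
      using sym by (simp add: inverses_13_def)
  qed
qed

text \<open>The remainder \<open>1 - a x\<close> of \<open>1\<close> lies in the right annihilator of \<open>a\<^sup>*\<close> exactly when the normal
  equation holds.\<close>

lemma left_mult_is_proj_along_iff: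
  assumes "involution star"
  shows "is_proj_along (left_mult (a * x)) (right_ideal_of a) (rann (star a)) \<longleftrightarrow>
    star a * a * x = star a"
proof
  assume "is_proj_along (left_mult (a * x)) (right_ideal_of a) (rann (star a))"
  then have "1 - a * x * 1 \<in> rann (star a)"
    unfolding is_proj_along_iff[OF additive_subgroup_ideals(1,3)] left_mult_def by blast
  then show "star a * a * x = star a"
    by (simp add: rann_def algebra_simps)
next
  assume normal: "star a * a * x = star a"
  then have fix_a: "a * x * a = a" and sym: "star (a * x) = a * x"
    using inverses_13_iff_normal_equation[OF assms] by (auto simp: inverses_13_def)
  have p_eq: "a * x = star x * star a"
    using assms sym by (simp add: involution_def)
  have "a * x * r \<in> right_ideal_of a" for r
    by (auto simp: right_ideal_of_def mult.assoc)
  moreover have "r - a * x * r \<in> rann (star a)" for r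
    using normal by (simp add: rann_def right_diff_distrib mult.assoc[symmetric])
  moreover have "a * x * s = s" if "s \<in> right_ideal_of a" for s
    using that fix_a by (auto simp: right_ideal_of_def mult.assoc[symmetric])
  moreover have "a * x * t = 0" if "t \<in> rann (star a)" for t
    using that by (simp add: p_eq rann_def mult.assoc)
  ultimately show "is_proj_along (left_mult (a * x)) (right_ideal_of a) (rann (star a))"
    unfolding is_proj_along_iff[OF additive_subgroup_ideals(1,3)] left_mult_def by blast
qed

text \<open>Here the normal equation says that right multiplication by \<open>a x\<close> fixes \<open>a\<^sup>*\<close>.\<close>

lemma right_mult_is_proj_along_iff:
  assumes "involution star"
  shows "is_proj_along (right_mult (a * x)) (left_ideal_of (star a)) (lann a) \<longleftrightarrow>
    star a * a * x = star a"
proof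
  assume "is_proj_along (right_mult (a * x)) (left_ideal_of (star a)) (lann a)"
  moreover have "star a \<in> left_ideal_of (star a)"
    unfolding left_ideal_of_def by (force intro: exI[of _ 1])
  ultimately have "star a * (a * x) = star a"
    unfolding is_proj_along_iff[OF additive_subgroup_ideals(2,4)] right_mult_def by blast
  then show "star a * a * x = star a"
    by (simp add: mult.assoc)
next
  assume normal: "star a * a * x = star a"
  then have fix_a: "a * x * a = a" and sym: "star (a * x) = a * x"
    using inverses_13_iff_normal_equation[OF assms] by (auto simp: inverses_13_def)
  have p_eq: "a * x = star x * star a"
    using assms sym by (simp add: involution_def)
  have "r * (a * x) \<in> left_ideal_of (star a)" for r
    unfolding p_eq left_ideal_of_def by (auto simp: mult.assoc[symmetric])
  moreover have "r - r * (a * x) \<in> lann a" for r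
    using fix_a by (simp add: lann_def left_diff_distrib mult.assoc)
  moreover have "s * (a * x) = s" if "s \<in> left_ideal_of (star a)" for s
    using that normal by (auto simp: left_ideal_of_def mult.assoc)
  moreover have "t * (a * x) = 0" if "t \<in> lann a" for t
    using that by (simp add: lann_def mult.assoc[symmetric])
  ultimately show "is_proj_along (right_mult (a * x)) (left_ideal_of (star a)) (lann a)"
    unfolding is_proj_along_iff[OF additive_subgroup_ideals(2,4)] right_mult_def by blast
qed

theorem theorem7p1:
  fixes star :: "'a::ring_1 \<Rightarrow> 'a" and a x :: 'a
  assumes "involution star"
  shows "(x \<in> inverses_13 star a \<longleftrightarrow>
            is_proj_along (left_mult (a * x)) (right_ideal_of a) (rann (star a))) \<and>
         (is_proj_along (left_mult (a * x)) (right_ideal_of a) (rann (star a)) \<longleftrightarrow>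
            is_proj_along (right_mult (a * x)) (left_ideal_of (star a)) (lann a))"
  using inverses_13_iff_normal_equation[OF assms] left_mult_is_proj_along_iff[OF assms]
    right_mult_is_proj_along_iff[OF assms]
  by blast

end
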